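(* Let $\mathbb{H}_1,\mathbb{H}_2$ be real Hilbert spaces and let $\mathcal{Z}$ be a finite-dimensional subspace of $\mathbb{K}(\mathbb{H}_1,\mathbb{H}_2)$. Let $T\in\mathbb{K}(\mathbb{H}_1,\mathbb{H}_2)\setminus\mathcal{Z}$. Then there exists $A_0\in\mathcal{Z}$ such that $$\operatorname{dist}(T,\mathcal{Z})=\sup\{\langle Tx,y\rangle:x\in S_{\mathbb{H}_1},\ y\in S_{\mathbb{H}_2},\ \langle A_0x,y\rangle=0\},$$ and moreover $A_0$ is a best approximation to $T$ in $\mathcal{Z}$, i.e. $\|T-A_0\|=\operatorname{dist}(T,\mathcal{Z})$.
   Context: All spaces are real. $\mathbb{K}(\mathbb{H}_1,\mathbb{H}_2)$ is the space of compact linear operators from $\mathbb{H}_1$ to $\mathbb{H}_2$ with the operator norm, $\operatorname{dist}(T,\mathcal{Z})=\inf_{B\in\mathcal{Z}}\|T-B\|$, and $S_{\mathbb{H}_i}$ is the unit sphere of $\mathbb{H}_i$. $\langle\cdot,\cdot\rangle$ is the inner product of $\mathbb{H}_2$. *)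

theory Defs
  imports "HOL-Analysis.Analysis"
begin

(* A compact linear operator is automatically bounded, so nothing is lost by carving the
   compact operators out of the type of bounded linear operators; its norm is the
   operator norm. *)
definition compact_operators ::
    "('a::real_normed_vector \<Rightarrow>\<^sub>L 'b::real_normed_vector) set" where
  "compact_operators =
     {T. \<forall>S. bounded S \<longrightarrow> compact (closure (blinfun_apply T ` S))}"

definition finite_dimensional_subspace :: "'a::real_vector set \<Rightarrow> bool" where
  "finite_dimensional_subspace Z \<longleftrightarrow>
     subspace Z \<and> (\<exists>B. finite B \<and> span B = Z)"

end

theory Submission
  imports Defs
begin

text \<open>
  Any best approximation \<open>A0\<close> of \<open>T\<close> in \<open>Z\<close> works. If \<open>A0 x\<close> is orthogonal to \<open>y\<close>, then
  \<open>T x \<bullet> y = (T - A0) x \<bullet> y\<close> is at most the distance. For the converse, \<open>S = T - A0\<close> satisfies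
  \<open>\<parallel>S\<parallel> \<le> \<parallel>S + t A0\<parallel>\<close> for all real \<open>t\<close>, so by the Bhatia--Semrl theorem for compact operators there is a
  unit vector \<open>x\<close> at which \<open>S\<close> attains its norm and \<open>S x\<close> is orthogonal to \<open>A0 x\<close>; take
  \<open>y = S x / \<parallel>S\<parallel>\<close>.
\<close>

section \<open>Best approximation in finite-dimensional subspaces\<close>

text \<open>A convergent sequence is bounded, so it stays in a single compact slice. In the
  induction below this makes spans closed.\<close>

lemma closed_if_compact_Int_cball:
  fixes X :: "'a::real_normed_vector set"
  assumes "\<And>r. compact (X \<inter> cball 0 r)"
  shows "closed X"
  unfolding closed_sequential_limits
proof (intro allI impI)
  fix f l assume fl: "(\<forall>n. f n \<in> X) \<and> f \<longlonglongrightarrow> l"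
  then have "bounded (range f)"
    by (auto intro: convergent_imp_bounded)
  then obtain r where "\<And>n. norm (f n) \<le> r"
    by (auto simp: bounded_iff)
  with fl have "\<forall>n. f n \<in> X \<inter> cball 0 r" by auto
  with fl assms[of r] have "l \<in> X \<inter> cball 0 r"
    by (meson closed_sequentially compact_imp_closed)
  then show "l \<in> X" by simp
qed

text \<open>Induction on the generators: the coordinate along a new vector is controlled by its
  distance to the old span, so each slice is a closed part of a continuous image of a compact
  product.\<close>

lemma compact_span_Int_cball:
  fixes B :: "'a::real_normed_vector set"
  assumes "finite B"
  shows "compact (span B \<inter> cball 0 r)"
  using assms
proof (induction B arbitrary: r rule: finite_induct)
  case empty
  \<comment> \<open>The ball is empty when \<open>r\<close> is negative.\<close>
  have "{0::'a} \<inter> cball 0 r = {} \<or> {0::'a} \<inter> cball 0 r = {0}" by auto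
  then show ?case by (metis compact_empty compact_sing span_empty)
next
  case (insert b B)
  show ?case
  proof (cases "b \<in> span B")
    case True
    then show ?thesis using insert.IH by (simp add: span_redundant)
  next
    case False
    define \<delta> where "\<delta> = infdist b (span B)"
    have "closed (span B)"
      using insert.IH by (rule closed_if_compact_Int_cball)
    then have \<delta>: "\<delta> > 0"
      using False infdist_pos_not_in_closed[of "span B" b] span_zero[of B] unfolding \<delta>_def by fastforce
    \<comment> \<open>Factoring out \<open>c\<close> leaves the distance from \<open>b\<close> to a
      point of \<open>span B\<close>.\<close>
    have coord: "\<bar>c\<bar> * \<delta> \<le> norm (c *\<^sub>R b + v)" if v: "v \<in> span B" for c v
    proof (cases "c = 0")
      case False
      have "\<delta> \<le> dist b (- (1/c) *\<^sub>R v)"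
        unfolding \<delta>_def using v by (intro infdist_le span_scale)
      then have "\<bar>c\<bar> * \<delta> \<le> norm (c *\<^sub>R (b + (1/c) *\<^sub>R v))"
        by (simp add: dist_norm mult_left_mono)
      also have "c *\<^sub>R (b + (1/c) *\<^sub>R v) = c *\<^sub>R b + v"
        using False by (simp add: scaleR_right_distrib)
      finally show ?thesis .
    qed auto
    \<comment> \<open>For \<open>c *\<^sub>R b + v\<close> in the ball, \<open>coord\<close> bounds
      \<open>c\<close> by \<open>C\<close>, and the triangle inequality then bounds
      \<open>v\<close>.\<close>
    define C where "C = r / \<delta>"
    define P where "P = (\<lambda>(c, v). c *\<^sub>R b + v) ` ({-C..C} \<times> (span B \<inter> cball 0 (r + C * norm b)))"
    have "compact P"
      unfolding P_def case_prod_unfold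
      by (intro compact_continuous_image continuous_intros compact_Times insert.IH compact_Icc)
    moreover have "span (insert b B) \<inter> cball 0 r = P \<inter> cball 0 r"
    proof (intro equalityI subsetI)
      fix u assume u: "u \<in> span (insert b B) \<inter> cball 0 r"
      then obtain c where "u - c *\<^sub>R b \<in> span B"
        by (auto simp: span_insert)
      moreover define v where "v = u - c *\<^sub>R b"
      ultimately have v: "v \<in> span B" and uv: "u = c *\<^sub>R b + v" by auto
      have "\<bar>c\<bar> * \<delta> \<le> r"
        using coord[OF v, of c] u uv by simp
      then have c: "\<bar>c\<bar> \<le> C"
        unfolding C_def using \<delta> by (simp add: field_simps)
      have "norm v \<le> norm u + norm (c *\<^sub>R b)"
        unfolding v_def by (rule norm_triangle_ineq4)
      also have "\<dots> \<le> r + C * norm b"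
        using u c by (simp add: add_mono mult_right_mono)
      finally show "u \<in> P \<inter> cball 0 r"
        unfolding P_def using u uv v c by (force simp: abs_le_iff)
    next
      have "span B \<subseteq> span (insert b B)" by (intro span_mono) auto
      moreover have "b \<in> span (insert b B)" by (intro span_base) auto
      moreover fix u assume "u \<in> P \<inter> cball 0 r"
      ultimately show "u \<in> span (insert b B) \<inter> cball 0 r"
        unfolding P_def by (auto intro!: span_add span_scale)
    qed
    ultimately show ?thesis
      by (simp add: compact_Int_closed)
  qed
qed

lemma best_approximation_exists:
  fixes X :: "'a::real_normed_vector set"
  assumes cpt: "\<And>r. compact (X \<inter> cball 0 r)" and "X \<noteq> {}"
  obtains a where "a \<in> X" "norm (x - a) = infdist x X"
proof -
  obtain a0 where a0: "a0 \<in> X" using \<open>X \<noteq> {}\<close> by auto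
  \<comment> \<open>Points outside this ball are farther from \<open>x\<close> than
    \<open>a0\<close> is, so minimizing over one compact slice suffices.\<close>
  define r where "r = norm x + norm (x - a0)"
  have *: "a \<in> cball 0 r" if "norm (x - a) \<le> norm (x - a0)" for a
    using norm_triangle_ineq3[of a x] that by (simp add: r_def norm_minus_commute)
  have "\<exists>a\<in>X \<inter> cball 0 r. \<forall>b\<in>X \<inter> cball 0 r. norm (x - a) \<le> norm (x - b)"
    using a0 * by (intro continuous_attains_inf cpt continuous_intros) auto
  then obtain a where a: "a \<in> X" "\<And>b. b \<in> X \<inter> cball 0 r \<Longrightarrow> norm (x - a) \<le> norm (x - b)"
    by auto
  have "norm (x - a) \<le> norm (x - b)" if "b \<in> X" for b
    using a(2)[of b] a(2)[of a0] * a0 that by (meson IntI order_refl order_trans linear)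
  then have "norm (x - a) \<le> infdist x X"
    using \<open>X \<noteq> {}\<close> by (auto simp: infdist_notempty dist_norm intro: cINF_greatest)
  moreover have "infdist x X \<le> norm (x - a)"
    using infdist_le[OF a(1), of x] by (simp add: dist_norm)
  ultimately show ?thesis
    using that a(1) by force
qed

section \<open>Norm attainment and the Bhatia--Semrl theorem\<close>

lemma compact_operators_diff:
  assumes "S \<in> compact_operators" "T \<in> compact_operators"
  shows "S - T \<in> compact_operators"
  unfolding compact_operators_def
proof (clarify)
  fix X :: "'a set" assume "bounded X"
  define D where "D = {x - y | x y. x \<in> closure (S ` X) \<and> y \<in> closure (T ` X)}"
  have D: "compact D"
    unfolding D_def using assms \<open>bounded X\<close>
    by (intro compact_differences) (auto simp: compact_operators_def)
  have "(S - T) ` X \<subseteq> D"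
    unfolding D_def by (auto simp: blinfun.diff_left intro: closure_subset[THEN subsetD])
  then have "closure ((S - T) ` X) \<subseteq> D"
    by (simp add: D closure_minimal compact_imp_closed)
  then show "compact (closure ((S - T) ` X))"
    using compact_Int_closed[OF D closed_closure] by (metis inf.absorb2)
qed

lemma blinfun_norm_approx:
  fixes f :: "'a::real_normed_vector \<Rightarrow>\<^sub>L 'b::real_normed_vector"
  assumes "0 \<le> c" "c < norm f"
  obtains x where "norm x = 1" "c < norm (f x)"
proof -
  have "\<exists>x. c * norm x < norm (f x)"
    using norm_blinfun_bound[OF \<open>0 \<le> c\<close>, of f] \<open>c < norm f\<close> by (meson not_le)
  then obtain x where x: "c * norm x < norm (f x)" by auto
  then have "x \<noteq> 0" by auto
  with x have "c < norm (f (x /\<^sub>R norm x))"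
    by (simp add: blinfun.scaleR_right field_simps)
  with \<open>x \<noteq> 0\<close> show ?thesis by (intro that[of "x /\<^sub>R norm x"]) auto
qed

lemma parallelogram_law:
  fixes x y :: "'a::real_inner"
  shows "(norm (x + y))\<^sup>2 + (norm (x - y))\<^sup>2 = 2 * (norm x)\<^sup>2 + 2 * (norm y)\<^sup>2"
  by (simp add: power2_norm_eq_inner inner_add inner_diff inner_commute)

text \<open>If \<open>S x\<^sub>n\<close> is Cauchy, the parallelogram law in the codomain forces \<open>\<parallel>S (x\<^sub>n + x\<^sub>m)\<parallel>\<close> to
  approach \<open>2 \<parallel>S\<parallel>\<close>, so \<open>\<parallel>x\<^sub>n + x\<^sub>m\<parallel>\<close> approaches 2, and the parallelogram law in the domain makes
  \<open>x\<^sub>n\<close> Cauchy. No weak compactness is needed.\<close>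

lemma maximizing_sequence_subconverges:
  fixes S :: "'a::{real_inner, complete_space} \<Rightarrow>\<^sub>L 'b::real_inner"
  assumes S: "S \<in> compact_operators" "S \<noteq> 0"
    and x: "\<And>n. norm (x n) = 1" and lim: "(\<lambda>n. norm (S (x n))) \<longlonglongrightarrow> norm S"
  obtains r :: "nat \<Rightarrow> nat" and l where "strict_mono r" "(x \<circ> r) \<longlonglongrightarrow> l"
proof -
  have "bounded (sphere (0::'a) 1)" by (auto simp: bounded_iff)
  then have "compact (closure (S ` sphere 0 1))"
    using S by (simp add: compact_operators_def)
  then have "seq_compact (closure (S ` sphere 0 1))"
    by (rule compact_imp_seq_compact)
  moreover have "\<forall>n. S (x n) \<in> closure (S ` sphere 0 1)"
    using x by (auto intro!: closure_subset[THEN subsetD])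
  ultimately obtain z and r :: "nat \<Rightarrow> nat"
    where r: "strict_mono r" and z: "((\<lambda>n. S (x n)) \<circ> r) \<longlonglongrightarrow> z"
    by (rule seq_compactE)
  define y where "y = x \<circ> r"
  have y: "norm (y n) = 1" for n by (simp add: y_def x)
  have Sy: "(\<lambda>n. S (y n)) \<longlonglongrightarrow> z" using z by (simp add: y_def o_def)
  have "((\<lambda>n. norm (S (x n))) \<circ> r) \<longlonglongrightarrow> norm S"
    using lim r by (rule LIMSEQ_subseq_LIMSEQ)
  then have nSy: "(\<lambda>n. norm (S (y n))) \<longlonglongrightarrow> norm S"
    by (simp add: y_def o_def)
  define s where "s = norm S"
  have s: "s > 0" using S by (simp add: s_def)
  define d where "d = (\<lambda>n. s\<^sup>2 - (norm (S (y n)))\<^sup>2)"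
  define e where "e = (\<lambda>n. norm (S (y n) - z))"
  \<comment> \<open>The estimate of \<open>S (y m + y n)\<close> by
    \<open>s * norm (y m + y n)\<close> links the two parallelogram laws. \<open>d\<close> is the
    deficit from the maximal norm, \<open>e\<close> the distance to the limit
    \<open>z\<close>.\<close>
  have key: "s\<^sup>2 * (norm (y m - y n))\<^sup>2 \<le> 2 * d m + 2 * d n + (e m + e n)\<^sup>2" for m n
  proof -
    have "norm (S (y m - y n)) \<le> e m + e n"
      using norm_triangle_ineq4[of "S (y m) - z" "S (y n) - z"]
      by (simp add: e_def blinfun.diff_right)
    then have 1: "(norm (S (y m - y n)))\<^sup>2 \<le> (e m + e n)\<^sup>2"
      by (simp add: power_mono)
    have "norm (S (y m + y n)) \<le> s * norm (y m + y n)"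
      unfolding s_def by (rule norm_blinfun)
    then have 2: "(norm (S (y m + y n)))\<^sup>2 \<le> s\<^sup>2 * (norm (y m + y n))\<^sup>2"
      by (metis norm_ge_zero power_mono power_mult_distrib)
    have "s\<^sup>2 * ((norm (y m + y n))\<^sup>2 + (norm (y m - y n))\<^sup>2) = 4 * s\<^sup>2"
      by (simp add: parallelogram_law y)
    then show ?thesis
      using 1 2 parallelogram_law[of "S (y m)" "S (y n)"]
      by (simp add: d_def blinfun.add_right blinfun.diff_right algebra_simps)
  qed
  have "(\<lambda>n. s\<^sup>2 - (norm (S (y n)))\<^sup>2) \<longlonglongrightarrow> s\<^sup>2 - s\<^sup>2"
    using nSy unfolding s_def by (intro tendsto_intros)
  then have d0: "d \<longlonglongrightarrow> 0" by (simp add: d_def)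
  have e0: "e \<longlonglongrightarrow> 0" unfolding e_def by (intro tendsto_norm_zero LIM_zero Sy)
  have "Cauchy y"
  proof (rule CauchyI)
    fix \<epsilon> :: real assume "\<epsilon> > 0"
    \<comment> \<open>In \<open>key\<close>, the thresholds below leave less than half of
      \<open>\<eta>\<close> for the \<open>d\<close> terms and at most a quarter for the
      \<open>e\<close> term.\<close>
    define \<eta> where "\<eta> = (s * \<epsilon>)\<^sup>2"
    have \<eta>: "\<eta> > 0" using \<open>\<epsilon> > 0\<close> s by (simp add: \<eta>_def)
    have "\<forall>\<^sub>F n in sequentially. d n < \<eta> / 8"
      using \<eta> by (intro order_tendstoD(2)[OF d0]) auto
    moreover have "\<forall>\<^sub>F n in sequentially. e n < sqrt \<eta> / 4"
      using \<eta> by (intro order_tendstoD(2)[OF e0]) auto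
    ultimately have "\<forall>\<^sub>F n in sequentially. d n < \<eta> / 8 \<and> e n < sqrt \<eta> / 4"
      by (rule eventually_conj)
    then obtain N where N: "\<And>n. n \<ge> N \<Longrightarrow> d n < \<eta> / 8 \<and> e n < sqrt \<eta> / 4"
      unfolding eventually_sequentially by blast
    have "norm (y m - y n) < \<epsilon>" if "m \<ge> N" "n \<ge> N" for m n
    proof -
      have "e m + e n \<le> sqrt \<eta> / 2" using N[OF that(1)] N[OF that(2)] by simp
      then have "(e m + e n)\<^sup>2 \<le> (sqrt \<eta> / 2)\<^sup>2"
        by (intro power_mono) (auto simp: e_def)
      also have "\<dots> = \<eta> / 4" using \<eta> by (simp add: power_divide)
      finally have "s\<^sup>2 * (norm (y m - y n))\<^sup>2 < \<eta>"
        using key[of m n] N[OF that(1)] N[OF that(2)] \<eta> by linarith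
      then have "(s * norm (y m - y n))\<^sup>2 < (s * \<epsilon>)\<^sup>2"
        by (simp only: power_mult_distrib \<eta>_def)
      then have "s * norm (y m - y n) < s * \<epsilon>"
        using s \<open>\<epsilon> > 0\<close> by (simp only: power2_less_imp_less[of _ "s * \<epsilon>"] mult_nonneg_nonneg less_imp_le)
      then show ?thesis using s by simp
    qed
    then show "\<exists>M. \<forall>m\<ge>M. \<forall>n\<ge>M. norm (y m - y n) < \<epsilon>" by blast
  qed
  then obtain l where "y \<longlonglongrightarrow> l"
    by (auto simp: Cauchy_convergent_iff convergent_def)
  then show ?thesis unfolding y_def by (rule that[OF r])
qed

text \<open>One-sided half of Bhatia--Semrl: near-maximizers of \<open>S + t *\<^sub>R A\<close>
  become maximizing for \<open>S\<close> as \<open>t\<close> tends to 0, and a limit point of them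
  inherits the sign of the inner product.\<close>

lemma norm_attained_nonneg_inner:
  fixes S A :: "'a::{real_inner, complete_space} \<Rightarrow>\<^sub>L 'b::real_inner"
  assumes S: "S \<in> compact_operators" "S \<noteq> 0"
    and orth: "\<And>t. t > 0 \<Longrightarrow> norm S \<le> norm (S + t *\<^sub>R A)"
  obtains x where "norm x = 1" "norm (S x) = norm S" "S x \<bullet> A x \<ge> 0"
proof -
  define s where "s = norm S"
  have s: "s > 0" using S by (simp add: s_def)
  define t where "t = (\<lambda>n. inverse (real (Suc n)))"
  have t: "0 < t n" "t n \<le> 1" for n by (simp_all add: t_def field_simps)
  have t0: "t \<longlonglongrightarrow> 0" unfolding t_def by (rule LIMSEQ_inverse_real_of_nat)
  \<comment> \<open>The slack is quadratic in \<open>t n\<close>, so it still vanishes after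
    division by \<open>t n\<close>.\<close>
  have "\<exists>x. norm x = 1 \<and> s * (1 - (t n)\<^sup>2) < norm ((S + t n *\<^sub>R A) x)" for n
  proof -
    have "0 \<le> s * (1 - (t n)\<^sup>2)"
      using s t[of n] by (simp add: power_le_one)
    moreover have "s * (1 - (t n)\<^sup>2) < s * 1"
      using s t[of n] by (intro mult_strict_left_mono) auto
    ultimately show ?thesis
      using orth[OF t(1)[of n]] blinfun_norm_approx[of "s * (1 - (t n)\<^sup>2)" "S + t n *\<^sub>R A"]
      by (metis less_le_trans mult.right_neutral s_def)
  qed
  then obtain x where x: "\<And>n. norm (x n) = 1"
    and big: "\<And>n. s * (1 - (t n)\<^sup>2) < norm ((S + t n *\<^sub>R A) (x n))"
    by metis
  have Sx: "norm (S (x n)) \<le> s" and Ax: "norm (A (x n)) \<le> norm A" for n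
    using norm_blinfun[of S "x n"] norm_blinfun[of A "x n"] x[of n] by (simp_all add: s_def)
  have lower: "s * (1 - (t n)\<^sup>2) - t n * norm A \<le> norm (S (x n))" for n
  proof -
    have "norm ((S + t n *\<^sub>R A) (x n)) \<le> norm (S (x n)) + t n * norm (A (x n))"
      using norm_triangle_ineq[of "S (x n)" "t n *\<^sub>R A (x n)"] t[of n]
      by (simp add: blinfun.add_left blinfun.scaleR_left)
    moreover have "t n * norm (A (x n)) \<le> t n * norm A"
      using Ax[of n] t[of n] by (intro mult_left_mono) auto
    ultimately show ?thesis using big[of n] by linarith
  qed
  have inner: "- t n * (2 * s\<^sup>2 + (norm A)\<^sup>2) \<le> 2 * (S (x n) \<bullet> A (x n))" for n
  proof -
    define p where "p = S (x n) \<bullet> A (x n)"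
    have "s\<^sup>2 * (1 - 2 * (t n)\<^sup>2) \<le> s\<^sup>2 * (1 - (t n)\<^sup>2)\<^sup>2"
      by (intro mult_left_mono) (simp_all add: power2_diff)
    also have "\<dots> = (s * (1 - (t n)\<^sup>2))\<^sup>2" by (simp add: power_mult_distrib)
    also have "\<dots> \<le> (norm ((S + t n *\<^sub>R A) (x n)))\<^sup>2"
      using big[of n] s t[of n] by (intro power_mono) (auto simp: power_le_one)
    also have "\<dots> = (norm (S (x n)))\<^sup>2 + 2 * t n * p + (t n)\<^sup>2 * (norm (A (x n)))\<^sup>2"
      using dot_norm[of "S (x n)" "t n *\<^sub>R A (x n)"]
      by (simp add: p_def blinfun.add_left blinfun.scaleR_left power_mult_distrib)
    also have "\<dots> \<le> s\<^sup>2 + 2 * t n * p + (t n)\<^sup>2 * (norm A)\<^sup>2"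
      using Sx[of n] Ax[of n] t[of n] by (intro add_mono mult_left_mono power_mono) auto
    finally have "t n * (- t n * (2 * s\<^sup>2 + (norm A)\<^sup>2)) \<le> t n * (2 * p)"
      by (simp add: algebra_simps power2_eq_square)
    then show ?thesis using t[of n] unfolding p_def by (simp only: mult_le_cancel_left_pos)
  qed
  have "(\<lambda>n. s * (1 - (t n)\<^sup>2) - t n * norm A) \<longlonglongrightarrow> s * (1 - 0\<^sup>2) - 0 * norm A"
    by (intro tendsto_intros t0)
  then have "(\<lambda>n. s * (1 - (t n)\<^sup>2) - t n * norm A) \<longlonglongrightarrow> s" by simp
  from tendsto_sandwich[OF _ _ this tendsto_const]
  have lim: "(\<lambda>n. norm (S (x n))) \<longlonglongrightarrow> s"
    using lower Sx by simp
  obtain r :: "nat \<Rightarrow> nat" and l where r: "strict_mono r" and l: "(x \<circ> r) \<longlonglongrightarrow> l"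
    by (rule maximizing_sequence_subconverges[OF S, of x, OF x lim[unfolded s_def]])
  have "(\<lambda>n. norm ((x \<circ> r) n)) \<longlonglongrightarrow> norm l" using l by (rule tendsto_norm)
  then have l1: "norm l = 1" using x by (simp add: LIMSEQ_const_iff)
  have "(\<lambda>n. norm (S ((x \<circ> r) n))) \<longlonglongrightarrow> norm (S l)"
    by (intro tendsto_intros l)
  moreover have "(\<lambda>n. norm (S ((x \<circ> r) n))) \<longlonglongrightarrow> s"
    using LIMSEQ_subseq_LIMSEQ[OF lim r] by (simp add: o_def)
  ultimately have Sl: "norm (S l) = s" by (rule LIMSEQ_unique)
  have "(\<lambda>n. - (t \<circ> r) n * (2 * s\<^sup>2 + (norm A)\<^sup>2)) \<longlonglongrightarrow> - 0 * (2 * s\<^sup>2 + (norm A)\<^sup>2)"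
    by (intro tendsto_intros LIMSEQ_subseq_LIMSEQ[OF t0 r])
  moreover have "(\<lambda>n. 2 * (S ((x \<circ> r) n) \<bullet> A ((x \<circ> r) n))) \<longlonglongrightarrow> 2 * (S l \<bullet> A l)"
    by (intro tendsto_intros l)
  ultimately have "- 0 * (2 * s\<^sup>2 + (norm A)\<^sup>2) \<le> 2 * (S l \<bullet> A l)"
    by (rule LIMSEQ_le) (use inner in auto)
  then show ?thesis using that l1 Sl unfolding s_def by simp
qed

text \<open>By the parallelogram law, norm-attaining vectors together with 0 form a subspace.\<close>

lemma norm_attaining_add:
  fixes S :: "'a::real_inner \<Rightarrow>\<^sub>L 'b::real_inner"
  assumes "norm (S x) = norm S * norm x" "norm (S y) = norm S * norm y"
  shows "norm (S (x + y)) = norm S * norm (x + y)"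
proof -
  define s where "s = norm S"
  have le: "(norm (S z))\<^sup>2 \<le> s\<^sup>2 * (norm z)\<^sup>2" for z
    unfolding s_def by (metis norm_blinfun norm_ge_zero power_mono power_mult_distrib)
  have "(norm (S (x + y)))\<^sup>2 + (norm (S (x - y)))\<^sup>2 = s\<^sup>2 * ((norm (x + y))\<^sup>2 + (norm (x - y))\<^sup>2)"
    unfolding blinfun.add_right blinfun.diff_right parallelogram_law
    by (simp add: assms s_def power_mult_distrib algebra_simps)
  then have "(norm (S (x + y)))\<^sup>2 = (norm S * norm (x + y))\<^sup>2"
    using le[of "x + y"] le[of "x - y"] by (simp add: power_mult_distrib s_def algebra_simps)
  then show ?thesis by (simp add: power2_eq_iff_nonneg)
qed

theorem bhatia_semrl_compact:
  fixes S A :: "'a::{real_inner, complete_space} \<Rightarrow>\<^sub>L 'b::real_inner"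
  assumes S: "S \<in> compact_operators" "S \<noteq> 0"
    and orth: "\<And>t. norm S \<le> norm (S + t *\<^sub>R A)"
  obtains x where "norm x = 1" "norm (S x) = norm S" "S x \<bullet> A x = 0"
proof -
  obtain x where x: "norm x = 1" "norm (S x) = norm S" "S x \<bullet> A x \<ge> 0"
    by (rule norm_attained_nonneg_inner[OF S orth])
  have "norm S \<le> norm (S + t *\<^sub>R (- A))" for t
    using orth[of "- t"] by simp
  from norm_attained_nonneg_inner[OF S this]
  obtain y where y: "norm y = 1" "norm (S y) = norm S" "S y \<bullet> A y \<le> 0"
    by (metis blinfun.minus_left inner_minus_right neg_0_le_iff_le)
  define w where "w = (\<lambda>u::real. (1 - u) *\<^sub>R x + u *\<^sub>R y)"
  have "\<exists>u\<ge>0. u \<le> 1 \<and> S (w u) \<bullet> A (w u) = 0"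
    using x y unfolding w_def
    by (intro IVT2') (auto intro!: continuous_intros)
  then obtain u where u: "0 \<le> u" "u \<le> 1" "S (w u) \<bullet> A (w u) = 0" by blast
  have Sw: "norm (S (w u)) = norm S * norm (w u)"
    unfolding w_def by (rule norm_attaining_add) (simp_all add: blinfun.scaleR_right x y)
  show ?thesis
  proof (cases "w u = 0")
    case True
    then have "(1 - u) *\<^sub>R x = - (u *\<^sub>R y)"
      by (simp add: w_def eq_neg_iff_add_eq_0)
    moreover from this have "norm ((1 - u) *\<^sub>R x) = norm (u *\<^sub>R y)" by simp
    then have "u = 1 / 2" using u x y by simp
    ultimately have "x = - y"
      by (simp flip: scaleR_minus_right)
    with x y have "S x \<bullet> A x = 0" by (simp add: blinfun.minus_right)
    with x that show ?thesis by blast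
  next
    case False
    show ?thesis
      by (rule that[of "w u /\<^sub>R norm (w u)"])
        (use False Sw u in \<open>simp_all add: blinfun.scaleR_right\<close>)
  qed
qed

section \<open>The distance formula\<close>

theorem theorem2p11:
  fixes T :: "'a::{real_inner, complete_space} \<Rightarrow>\<^sub>L 'b::{real_inner, complete_space}"
    and Z :: "('a \<Rightarrow>\<^sub>L 'b) set"
  assumes "finite_dimensional_subspace Z"
    and "Z \<subseteq> compact_operators"
    and "T \<in> compact_operators - Z"
  shows "\<exists>A0\<in>Z.
      ereal (infdist T Z) =
        Sup {ereal (blinfun_apply T x \<bullet> y) | x y.
               x \<in> sphere 0 1 \<and> y \<in> sphere 0 1 \<and> blinfun_apply A0 x \<bullet> y = 0}
      \<and> norm (T - A0) = infdist T Z"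
proof -
  obtain B where Z: "subspace Z" and B: "finite B" "span B = Z"
    using assms(1) by (auto simp: finite_dimensional_subspace_def)
  have "compact (Z \<inter> cball 0 r)" for r
    using compact_span_Int_cball[OF B(1)] B(2) by simp
  moreover have "Z \<noteq> {}" using Z subspace_0 by blast
  ultimately obtain A0 where A0: "A0 \<in> Z" "norm (T - A0) = infdist T Z"
    using best_approximation_exists by blast
  define S where "S = T - A0"
  have S: "S \<in> compact_operators" "S \<noteq> 0"
    using assms A0(1) by (auto simp: S_def intro!: compact_operators_diff)
  have "norm S \<le> norm (S + t *\<^sub>R A0)" for t
  proof -
    have "A0 - t *\<^sub>R A0 \<in> Z"
      using Z A0(1) by (intro subspace_diff subspace_scale)
    from infdist_le[OF this, of T] show ?thesis
      by (simp add: A0(2)[symmetric] S_def dist_norm algebra_simps)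
  qed
  then obtain x where x: "norm x = 1" "norm (S x) = norm S" "S x \<bullet> A0 x = 0"
    using bhatia_semrl_compact[OF S] by blast
  define y where "y = S x /\<^sub>R norm S"
  have y: "norm y = 1" "A0 x \<bullet> y = 0"
    using S x by (simp_all add: y_def inner_commute)
  have "S x \<bullet> y = norm S"
    using S x by (simp add: y_def dot_square_norm power2_eq_square)
  then have Txy: "T x \<bullet> y = norm S"
    using y by (simp add: S_def blinfun.diff_left inner_diff_left)
  let ?V = "{ereal (T x \<bullet> y) | x y. x \<in> sphere 0 1 \<and> y \<in> sphere 0 1 \<and> A0 x \<bullet> y = 0}"
  have "Sup ?V \<le> ereal (norm S)"
  proof (rule Sup_least, clarify)
    fix x y assume xy: "x \<in> sphere 0 1" "y \<in> sphere 0 1" "A0 x \<bullet> y = 0"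
    then have "T x \<bullet> y = S x \<bullet> y"
      by (simp add: S_def blinfun.diff_left inner_diff_left)
    also have "\<dots> \<le> norm (S x) * norm y" by (rule norm_cauchy_schwarz)
    also have "\<dots> \<le> norm S" using xy norm_blinfun[of S x] by simp
    finally show "ereal (T x \<bullet> y) \<le> ereal (norm S)" by simp
  qed
  moreover have "ereal (norm S) \<le> Sup ?V"
    using x(1) y by (intro Sup_upper) (auto simp: Txy[symmetric])
  ultimately show ?thesis
    using A0 unfolding S_def by (metis (no_types, lifting) order_antisym)
qed

end
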